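(* Let $(M,\operatorname{dist})$ be a compact metric space and let $f\colon M\to M$ be a homeomorphism. Then the following statements are equivalent: (1) $f$ is countably-expansive; (2) $f$ is measure-expansive.
   Context: Let $f\colon M\to M$ be a homeomorphism of a compact metric space $(M,\operatorname{dist})$. For $\delta>0$ and $x\in M$ define $$\Gamma_\delta(x)=\{y\in M:\operatorname{dist}(f^n(x),f^n(y))\leq\delta\text{ for all }n\in\mathbb{Z}\}.$$ $f$ is countably-expansive if there is $\delta>0$ such that for all $x\in M$ the set $\Gamma_\delta(x)$ is countable (finite sets, in particular singletons, count as countable). Given a Borel probability measure $\mu$ on $M$, $f$ is $\mu$-expansive if there is $\delta>0$ (which may depend on $\mu$) such that $\mu(\Gamma_\delta(x))=0$ for all $x\in M$. A Borel probability measure $\mu$ on $M$ is non-atomic if $\mu(\{x\})=0$ for all $x\in M$. $f$ is measure-expansive if it is $\mu$-expansive for every non-atomic Borel probability measure $\mu$ on $M$. *)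

theory Defs
  imports "HOL-Probability.Probability"
begin

text \<open>
  A metric space is a carrier set \<open>M\<close> in a type of class \<open>metric_space\<close>, with the restricted
  distance and topology.
\<close>

text \<open>Integer iterates; the inverse is taken on \<open>M\<close>, as \<open>f\<close> need not be injective outside it.\<close>

definition int_iterate :: "'a set \<Rightarrow> ('a \<Rightarrow> 'a) \<Rightarrow> int \<Rightarrow> 'a \<Rightarrow> 'a" where
  "int_iterate M f n =
     (if 0 \<le> n then f ^^ nat n else inv_into M f ^^ nat (- n))"

definition dyn_ball ::
  "'a::metric_space set \<Rightarrow> ('a \<Rightarrow> 'a) \<Rightarrow> real \<Rightarrow> 'a \<Rightarrow> 'a set" where
  "dyn_ball M f \<delta> x =
     {y \<in> M. \<forall>n::int. dist (int_iterate M f n x) (int_iterate M f n y) \<le> \<delta>}"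

definition countably_expansive :: "'a::metric_space set \<Rightarrow> ('a \<Rightarrow> 'a) \<Rightarrow> bool" where
  "countably_expansive M f \<longleftrightarrow> (\<exists>\<delta>>0. \<forall>x\<in>M. countable (dyn_ball M f \<delta> x))"

definition borel_prob_on :: "'a::metric_space set \<Rightarrow> 'a measure \<Rightarrow> bool" where
  "borel_prob_on M \<mu> \<longleftrightarrow>
     space \<mu> = M \<and> sets \<mu> = sets (restrict_space borel M) \<and> prob_space \<mu>"

definition non_atomic :: "'a set \<Rightarrow> 'a measure \<Rightarrow> bool" where
  "non_atomic M \<mu> \<longleftrightarrow> (\<forall>x\<in>M. measure \<mu> {x} = 0)"

text \<open>
  If \<open>f\<close> is a homeomorphism of \<open>M\<close> and \<open>x \<in> M\<close>, then \<open>dyn_ball M f \<delta> x\<close> is closed in \<open>M\<close>, so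
  the convention that non-measurable sets have measure \<open>0\<close> plays no role below.
\<close>

definition mu_expansive ::
  "'a::metric_space set \<Rightarrow> ('a \<Rightarrow> 'a) \<Rightarrow> 'a measure \<Rightarrow> bool" where
  "mu_expansive M f \<mu> \<longleftrightarrow> (\<exists>\<delta>>0. \<forall>x\<in>M. measure \<mu> (dyn_ball M f \<delta> x) = 0)"

definition measure_expansive :: "'a::metric_space set \<Rightarrow> ('a \<Rightarrow> 'a) \<Rightarrow> bool" where
  "measure_expansive M f \<longleftrightarrow>
     (\<forall>\<mu>. borel_prob_on M \<mu> \<and> non_atomic M \<mu> \<longrightarrow> mu_expansive M f \<mu>)"

end

theory Submission
  imports Defs
begin

text \<open>
  Countable sets are null for non-atomic measures, which gives one direction. Conversely, if
  \<open>f\<close> is not countably-expansive, then for every \<open>n\<close> some \<open>K\<^sub>n = \<Gamma>\<^bsub>1/(n+1)\<^esub>(x\<^sub>n)\<close> is an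
  uncountable compact set. A Cantor scheme in \<open>K\<^sub>n\<close>, indexed by binary expansions, gives a Borel
  map from the reals to \<open>K\<^sub>n\<close> that is injective on \<open>[0, 1)\<close>. The map \<open>\<Phi>\<close> that uses the \<open>n\<close>-th of
  these on \<open>[n, n + 1)\<close> has countable fibres, so it pushes a normal distribution forward to a
  non-atomic measure, and this measure is positive on every \<open>K\<^sub>n\<close>.
\<close>

section \<open>Splitting uncountable compact sets\<close>

text \<open>Otherwise each point of \<open>K\<close> has a ball meeting \<open>K\<close> in a
  countable set; by compactness finitely many of these cover \<open>K\<close>, which would then be
  countable.\<close>

lemma ex_condensation_point:
  fixes K :: "'a::metric_space set"
  assumes "compact K" "uncountable K"
  obtains p where "p \<in> K" "\<And>r. 0 < r \<Longrightarrow> uncountable (cball p r \<inter> K)"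
proof (rule ccontr)
  assume "\<not> thesis"
  with that have "\<forall>p\<in>K. \<exists>r>0. countable (cball p r \<inter> K)"
    by blast
  then obtain r where r: "\<And>p. p \<in> K \<Longrightarrow> 0 < r p \<and> countable (cball p (r p) \<inter> K)"
    by metis
  obtain D where D: "D \<subseteq> K" "finite D" "K \<subseteq> (\<Union>p\<in>D. ball p (r p))"
    by (rule compactE_image[OF assms(1), of K "\<lambda>p. ball p (r p)"]) (use r in force)+
  have "K \<subseteq> (\<Union>p\<in>D. cball p (r p) \<inter> K)"
    using D(3) ball_subset_cball by blast
  moreover have "countable (\<Union>p\<in>D. cball p (r p) \<inter> K)"
    using D r by (intro countable_UN) (auto simp: countable_finite)
  ultimately show False
    using assms(2) countable_subset by blast
qed

text \<open>Small closed balls around two distinct condensation points, intersected with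
  \<open>K\<close>, do the job. The second point is a condensation point of what remains after
  cutting out a ball around the first.\<close>

lemma uncountable_compact_split:
  fixes K :: "'a::metric_space set"
  assumes K: "compact K" "uncountable K" and "0 < e"
  obtains L R where "L \<subseteq> K" "R \<subseteq> K" "L \<inter> R = {}"
    "compact L" "uncountable L" "compact R" "uncountable R"
    "\<And>x y. x \<in> L \<Longrightarrow> y \<in> L \<Longrightarrow> dist x y \<le> e" "\<And>x y. x \<in> R \<Longrightarrow> y \<in> R \<Longrightarrow> dist x y \<le> e"
proof -
  obtain p where p: "p \<in> K" "\<And>r. 0 < r \<Longrightarrow> uncountable (cball p r \<inter> K)"
    using ex_condensation_point[OF K] by blast
  \<comment> \<open>The sets \<open>K - ball p (1 / Suc n)\<close> exhaust \<open>K\<close> except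
    for \<open>p\<close>, so they cannot all be countable.\<close>
  have "\<exists>n. uncountable (K - ball p (1 / Suc n))"
  proof (rule ccontr)
    assume "\<not> ?thesis"
    then have "countable (insert p (\<Union>n. K - ball p (1 / Suc n)))"
      by (intro countable_insert countable_UN) auto
    moreover have "K \<subseteq> insert p (\<Union>n. K - ball p (1 / Suc n))"
    proof
      fix x assume "x \<in> K"
      show "x \<in> insert p (\<Union>n. K - ball p (1 / Suc n))"
      proof (cases "x = p")
        case False
        then obtain n where "1 / Suc n < dist p x"
          using reals_Archimedean[of "dist p x"] by (auto simp: inverse_eq_divide)
        then show ?thesis using \<open>x \<in> K\<close> by (auto intro!: exI[of _ n])
      qed simp
    qed
    ultimately show False
      using K(2) countable_subset by blast
  qed
  then obtain n where n: "uncountable (K - ball p (1 / Suc n))" by blast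
  have "compact (K - ball p (1 / Suc n))"
    using K(1) by (simp add: compact_diff)
  from ex_condensation_point[OF this n] obtain q
    where q: "q \<in> K - ball p (1 / Suc n)"
      "\<And>r. 0 < r \<Longrightarrow> uncountable (cball q r \<inter> (K - ball p (1 / Suc n)))" by blast
  have q': "uncountable (cball q r \<inter> K)" if "0 < r" for r
    using q(2)[OF that] by (rule contrapos_nn) (auto elim: countable_subset[rotated])
  have "p \<noteq> q" using q by auto
  \<comment> \<open>The bound \<open>e / 2\<close> gives diameter at most \<open>e\<close>;
    \<open>dist p q / 3\<close> keeps the two closed balls disjoint, since a common point would
    force \<open>dist p q\<close> to be at most \<open>2 * r\<close>.\<close>
  define r where "r = min (e / 2) (dist p q / 3)"
  have r: "0 < r" "2 * r \<le> e" "3 * r \<le> dist p q"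
    using \<open>p \<noteq> q\<close> \<open>0 < e\<close> by (auto simp: r_def)
  show ?thesis
  proof (rule that[of "cball p r \<inter> K" "cball q r \<inter> K"])
    show "cball p r \<inter> K \<inter> (cball q r \<inter> K) = {}"
    proof (rule ccontr)
      assume "\<not> ?thesis"
      then obtain z where "dist p z \<le> r" "dist q z \<le> r" by auto
      with r dist_triangle2[of p q z] show False by simp
    qed
    show "compact (cball p r \<inter> K)" "compact (cball q r \<inter> K)"
      using K(1) by (auto intro: closed_Int_compact)
    show "uncountable (cball p r \<inter> K)" "uncountable (cball q r \<inter> K)"
      using p(2) q' r(1) by auto
    show "dist x y \<le> e" if "x \<in> cball p r \<inter> K" "y \<in> cball p r \<inter> K" for x y
      using that r(2) dist_triangle3[of x y p] by simp
    show "dist x y \<le> e" if "x \<in> cball q r \<inter> K" "y \<in> cball q r \<inter> K" for x y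
      using that r(2) dist_triangle3[of x y q] by simp
  qed auto
qed

section \<open>Borel parametrization of a Cantor subset\<close>

text \<open>A binary tree of sets: node \<open>k\<close> of level \<open>Suc n\<close> has parent
  \<open>k div 2\<close>. Nodes are all integers so that floors of \<open>2 ^ n * t\<close> can
  serve as addresses for every real \<open>t\<close>; distinct roots all carry \<open>K\<close>, so
  disjointness is claimed for siblings only.\<close>

lemma uncountable_compact_scheme:
  fixes K :: "'a::metric_space set"
  assumes "compact K" "uncountable K"
  obtains C :: "nat \<Rightarrow> int \<Rightarrow> 'a set" where
    "\<And>n k. C n k \<subseteq> K" "\<And>n k. compact (C n k)" "\<And>n k. C n k \<noteq> {}"
    "\<And>n k. C (Suc n) k \<subseteq> C n (k div 2)"
    "\<And>n k x y. x \<in> C (Suc n) k \<Longrightarrow> y \<in> C (Suc n) k \<Longrightarrow> dist x y \<le> (1 / 2) ^ n"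
    "\<And>n j k. j div 2 = k div 2 \<Longrightarrow> j \<noteq> k \<Longrightarrow> C (Suc n) j \<inter> C (Suc n) k = {}"
proof -
  define split where "split A n S \<longleftrightarrow>
      (\<forall>b. S b \<subseteq> A \<and> compact (S b) \<and> uncountable (S b) \<and> S b \<inter> S (\<not> b) = {} \<and>
          (\<forall>x\<in>S b. \<forall>y\<in>S b. dist x y \<le> (1 / 2) ^ n))"
    for A :: "'a set" and n :: nat and S
  have "\<exists>S. split A n S" if A: "compact A" "uncountable A" for A n
  proof -
    have pos: "0 < (1 / 2 :: real) ^ n" by simp
    obtain L R where "L \<subseteq> A" "R \<subseteq> A" "L \<inter> R = {}"
      "compact L" "uncountable L" "compact R" "uncountable R"
      "\<And>x y. x \<in> L \<Longrightarrow> y \<in> L \<Longrightarrow> dist x y \<le> (1 / 2) ^ n"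
      "\<And>x y. x \<in> R \<Longrightarrow> y \<in> R \<Longrightarrow> dist x y \<le> (1 / 2) ^ n"
      by (rule uncountable_compact_split[OF A pos]) (rule that)
    then show ?thesis
      unfolding split_def by (intro exI[of _ "\<lambda>b. if b then L else R"]) auto
  qed
  then obtain S where S0: "\<And>A n. compact A \<Longrightarrow> uncountable A \<Longrightarrow> split A n (S A n)"
    by metis
  have S: "S A n b \<subseteq> A" "compact (S A n b)" "uncountable (S A n b)"
      "S A n b \<inter> S A n (\<not> b) = {}" "\<forall>x\<in>S A n b. \<forall>y\<in>S A n b. dist x y \<le> (1 / 2) ^ n"
    if "compact A" "uncountable A" for A n b
    using spec[OF S0[OF that, of n, unfolded split_def], of b] by - (elim conjE, assumption)+
  \<comment> \<open>The children of node \<open>j\<close> are \<open>2 * j\<close> and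
    \<open>2 * j + 1\<close>, told apart by parity. \<open>F\<close> is the previous level.\<close>
  define C where "C = rec_nat (\<lambda>k::int. K) (\<lambda>n F k. S (F (k div 2)) n (even k))"
  have C0: "C 0 k = K" and CS: "C (Suc n) k = S (C n (k div 2)) n (even k)" for n and k :: int
    by (simp_all add: C_def)
  have cu: "compact (C n k)" "uncountable (C n k)" for n k
    by (induction n arbitrary: k) (simp_all only: C0 CS assms S not_False_eq_True)
  note SC = S[OF cu]
  show ?thesis
  proof (rule that[of C])
    show "C n k \<subseteq> K" for n k
    proof (induction n arbitrary: k)
      case 0
      show ?case by (simp add: C0)
    next
      case (Suc n)
      show ?case unfolding CS using SC(1) Suc by (rule order_trans)
    qed
    show "compact (C n k)" for n k
      by (rule cu)
    show "C n k \<noteq> {}" for n k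
      using cu[of n k] by auto
    show "C (Suc n) j \<inter> C (Suc n) k = {}" if "j div 2 = k div 2" "j \<noteq> k" for n j k
    proof -
      have "even j \<longleftrightarrow> \<not> even k"
        using that by presburger
      then have "C (Suc n) j = S (C n (k div 2)) n (odd k)"
        using that(1) by (simp add: CS)
      then show ?thesis
        using SC(4)[of n "k div 2" n "even k"] by (simp add: CS Int_commute)
    qed
    show "dist x y \<le> (1 / 2) ^ n" if "x \<in> C (Suc n) k" "y \<in> C (Suc n) k" for n k x y
      using that SC(5) unfolding CS by blast
  qed (simp add: CS SC(1))
qed

text \<open>The addresses of a real \<open>t\<close> at successive levels thus form a branch of the
  tree.\<close>

lemma floor_power2_Suc: "\<lfloor>2 ^ Suc n * t\<rfloor> div 2 = \<lfloor>2 ^ n * t\<rfloor>" for t :: real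
  using floor_divide_real_eq_div[of 2 "2 ^ Suc n * t"] by simp

text \<open>\<open>\<phi> t\<close> is a point in the intersection of the branch of
  \<open>t\<close>. Distinct reals in [0, 1) leave the root on branches that eventually separate,
  which gives injectivity.\<close>

lemma uncountable_compact_borel_embedding:
  fixes K :: "'a::metric_space set"
  assumes "compact K" "uncountable K"
  obtains \<phi> :: "real \<Rightarrow> 'a" where "\<phi> \<in> borel_measurable borel" "range \<phi> \<subseteq> K" "inj_on \<phi> {0..<1}"
proof -
  obtain C :: "nat \<Rightarrow> int \<Rightarrow> 'a set" where C:
    "\<And>n k. C n k \<subseteq> K" "\<And>n k. compact (C n k)" "\<And>n k. C n k \<noteq> {}"
    "\<And>n k. C (Suc n) k \<subseteq> C n (k div 2)"
    "\<And>n k x y. x \<in> C (Suc n) k \<Longrightarrow> y \<in> C (Suc n) k \<Longrightarrow> dist x y \<le> (1 / 2) ^ n"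
    "\<And>n j k. j div 2 = k div 2 \<Longrightarrow> j \<noteq> k \<Longrightarrow> C (Suc n) j \<inter> C (Suc n) k = {}"
    using uncountable_compact_scheme[OF assms] by blast
  define D where "D t n = C n \<lfloor>2 ^ n * t\<rfloor>" for t :: real and n
  have "D t (Suc n) \<subseteq> D t n" for t n
    unfolding D_def using C(4)[of n "\<lfloor>2 ^ Suc n * t\<rfloor>"] unfolding floor_power2_Suc .
  then have dec: "D t n \<subseteq> D t m" if "m \<le> n" for t m n
    using that by (rule lift_Suc_antimono_le)
  have "K \<inter> (\<Inter>n\<in>UNIV. D t n) \<noteq> {}" for t
  proof (rule compact_imp_fip_image[OF assms(1)])
    show "closed (D t n)" for n
      unfolding D_def by (intro compact_imp_closed C)
    \<comment> \<open>The sets are nested, so a finite intersection contains the set with the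
      largest index; inserting 0 covers the case of empty \<open>I\<close>.\<close>
    fix I :: "nat set" assume "finite I"
    then have "D t (Max (insert 0 I)) \<subseteq> (\<Inter>n\<in>I. D t n)"
      by (intro INT_greatest dec) simp
    moreover have "D t (Max (insert 0 I)) \<noteq> {}" "D t (Max (insert 0 I)) \<subseteq> K"
      using C(1,3) by (simp_all add: D_def)
    ultimately show "K \<inter> (\<Inter>n\<in>I. D t n) \<noteq> {}"
      by blast
  qed
  then have "\<exists>x. x \<in> K \<and> (\<forall>n. x \<in> D t n)" for t
    by blast
  then obtain \<phi> where \<phi>: "\<And>t. \<phi> t \<in> K" "\<And>t n. \<phi> t \<in> D t n"
    by metis
  \<comment> \<open>Arbitrary representatives of the nodes. For measurability, \<open>\<phi>\<close>
    is the pointwise limit of step functions that take the value \<open>c (Suc n) k\<close> on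
    dyadic intervals: both points lie in one node of diameter at most
    \<open>(1 / 2) ^ n\<close>.\<close>
  define c where "c n k = (SOME x. x \<in> C n k)" for n k
  have c: "c n k \<in> C n k" for n k
    unfolding c_def using C(3) by (simp add: some_in_eq)
  show ?thesis
  proof (rule that[of \<phi>])
    show "\<phi> \<in> borel_measurable borel"
    proof (rule borel_measurable_LIMSEQ_metric)
      fix n
      have "(\<lambda>t::real. \<lfloor>2 ^ Suc n * t\<rfloor>) \<in> borel \<rightarrow>\<^sub>M count_space UNIV"
        by measurable
      then show "(\<lambda>t::real. c (Suc n) \<lfloor>2 ^ Suc n * t\<rfloor>) \<in> borel_measurable borel"
        by (rule measurable_compose) simp
    next
      fix t :: real
      show "(\<lambda>n. c (Suc n) \<lfloor>2 ^ Suc n * t\<rfloor>) \<longlonglongrightarrow> \<phi> t"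
      proof (rule metric_tendsto_imp_tendsto)
        show "(\<lambda>n. (1 / 2) ^ n :: real) \<longlonglongrightarrow> 0"
          by (rule LIMSEQ_realpow_zero) auto
        show "\<forall>\<^sub>F n in sequentially.
            dist (c (Suc n) \<lfloor>2 ^ Suc n * t\<rfloor>) (\<phi> t) \<le> dist ((1 / 2) ^ n :: real) 0"
          using C(5)[OF c \<phi>(2)[unfolded D_def]] by (simp add: always_eventually)
      qed
    qed
    show "range \<phi> \<subseteq> K"
      using \<phi> by auto
    show "inj_on \<phi> {0..<1}"
    proof (rule inj_onI)
      fix s t assume st: "s \<in> {0..<1}" "t \<in> {0..<1}" "\<phi> s = \<phi> t"
      \<comment> \<open>On [0, 1) both branches start at node 0. At a first disagreement the nodes
        would be siblings, hence disjoint, yet both contain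
        \<open>\<phi> s = \<phi> t\<close>.\<close>
      have eq: "\<lfloor>2 ^ n * s\<rfloor> = \<lfloor>2 ^ n * t\<rfloor>" for n
      proof (induction n)
        case 0
        have "\<lfloor>s\<rfloor> = 0" "\<lfloor>t\<rfloor> = 0" using st by (auto simp: floor_eq_iff)
        then show ?case by simp
      next
        case (Suc n)
        show ?case
        proof (rule ccontr)
          assume "\<lfloor>2 ^ Suc n * s\<rfloor> \<noteq> \<lfloor>2 ^ Suc n * t\<rfloor>"
          then have "D s (Suc n) \<inter> D t (Suc n) = {}"
            unfolding D_def by (intro C(6)) (simp_all only: floor_power2_Suc Suc simp_thms)
          then show False
            using \<phi>(2)[of s "Suc n"] \<phi>(2)[of t "Suc n"] st(3) by auto
        qed
      qed
      show "s = t"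
      proof (rule ccontr)
        assume "s \<noteq> t"
        then obtain n where "(1 / 2) ^ n < \<bar>s - t\<bar>"
          using real_arch_pow_inv[of "\<bar>s - t\<bar>" "1 / 2"] by auto
        then have "1 < 2 ^ n * \<bar>s - t\<bar>"
          by (simp add: field_simps)
        also have "2 ^ n * \<bar>s - t\<bar> = \<bar>2 ^ n * s - 2 ^ n * t\<bar>"
          by (simp add: abs_mult flip: right_diff_distrib)
        finally show False
          using eq[of n] by linarith
      qed
    qed
  qed
qed

section \<open>A non-atomic measure charging countably many compact sets\<close>

text \<open>One measure must serve all \<open>K n\<close> at once, because the constant in
  \<open>mu_expansive\<close> is chosen after the measure.\<close>

lemma ex_non_atomic_positive_on:
  fixes M :: "'a::metric_space set" and K :: "nat \<Rightarrow> 'a set"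
  assumes "\<And>n. compact (K n)" "\<And>n. uncountable (K n)" "\<And>n. K n \<subseteq> M" "closed M"
  obtains \<mu> where "borel_prob_on M \<mu>" "non_atomic M \<mu>"
    "\<And>n A. A \<in> sets \<mu> \<Longrightarrow> K n \<subseteq> A \<Longrightarrow> 0 < measure \<mu> A"
proof -
  have "\<exists>\<phi>::real \<Rightarrow> 'a. \<phi> \<in> borel_measurable borel \<and> range \<phi> \<subseteq> K n \<and> inj_on \<phi> {0..<1}" for n
    using uncountable_compact_borel_embedding[OF assms(1,2)] by metis
  then obtain \<phi> :: "nat \<Rightarrow> real \<Rightarrow> 'a" where
    \<phi>: "\<And>n. \<phi> n \<in> borel_measurable borel" "\<And>n. range (\<phi> n) \<subseteq> K n" "\<And>n. inj_on (\<phi> n) {0..<1}"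
    by metis
  \<comment> \<open>For negative \<open>t\<close>, \<open>nat\<close> sends the floor to 0, so
    \<open>\<phi> 0\<close> is reused there; this keeps the fibres countable.\<close>
  define \<Phi> where "\<Phi> t = \<phi> (nat \<lfloor>t\<rfloor>) (frac t)" for t
  define N where "N = density lborel (normal_density 0 1)"
  interpret N: prob_space N
    unfolding N_def by (rule prob_space_normal_density) simp
  have space_N: "space N = UNIV"
    by (simp add: N_def)
  \<comment> \<open>The normal density vanishes nowhere: countable sets are null for
    \<open>N\<close> and intervals of length 1 are not.\<close>
  have N_null: "A \<in> null_sets N \<longleftrightarrow> A \<in> null_sets lborel" for A
  proof -
    have "normal_density 0 1 x \<noteq> 0" for x
      using normal_density_pos[of 1 0 x] by simp
    then show ?thesis
      unfolding N_def by (subst null_sets_density_iff) (auto simp: AE_not_in, simp add: AE_iff_null_sets)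
  qed
  have "\<Phi> \<in> borel_measurable borel"
    unfolding \<Phi>_def
  proof (rule measurable_compose_countable)
    show "(\<lambda>t. \<phi> n (frac t)) \<in> borel_measurable borel" for n
      by (rule measurable_compose[OF _ \<phi>(1)]) (simp add: frac_def)
  qed measurable
  moreover have "\<Phi> t \<in> M" for t
    using \<phi>(2) assms(3) unfolding \<Phi>_def by blast
  ultimately have \<Phi>: "\<Phi> \<in> N \<rightarrow>\<^sub>M restrict_space borel M"
    by (intro measurable_restrict_space2) (auto simp: N_def)
  have fibre: "countable (\<Phi> -` {x})" for x
  proof -
    \<comment> \<open>Where the floor is constant, \<open>\<Phi>\<close> is injective, so each fibre
      has at most one point there.\<close>
    have "countable (\<Phi> -` {x} \<inter> {t. \<lfloor>t\<rfloor> = k})" for k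
    proof (rule countable_subset)
      have "inj_on \<Phi> {t. \<lfloor>t\<rfloor> = k}"
      proof (rule inj_onI)
        fix s t assume st: "s \<in> {t. \<lfloor>t\<rfloor> = k}" "t \<in> {t. \<lfloor>t\<rfloor> = k}" "\<Phi> s = \<Phi> t"
        then have "frac s = frac t"
          by (intro inj_onD[OF \<phi>(3)[of "nat k"]]) (auto simp: \<Phi>_def frac_ge_0 frac_lt_1)
        with st show "s = t" by (simp add: frac_def)
      qed
      then show "\<Phi> -` {x} \<inter> {t. \<lfloor>t\<rfloor> = k} \<subseteq> {the_inv_into {t. \<lfloor>t\<rfloor> = k} \<Phi> x}"
        using the_inv_into_f_f by fastforce
    qed simp
    then have "countable (\<Union>k. \<Phi> -` {x} \<inter> {t. \<lfloor>t\<rfloor> = k})"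
      by (intro countable_UN) auto
    moreover have "(\<Union>k. \<Phi> -` {x} \<inter> {t. \<lfloor>t\<rfloor> = k}) = \<Phi> -` {x}"
      by auto
    ultimately show ?thesis by simp
  qed
  define \<mu> where "\<mu> = distr N (restrict_space borel M) \<Phi>"
  show ?thesis
  proof (rule that[of \<mu>])
    show "borel_prob_on M \<mu>"
      unfolding borel_prob_on_def \<mu>_def using N.prob_space_distr[OF \<Phi>]
      by (simp add: space_restrict_space)
    show "non_atomic M \<mu>"
      unfolding non_atomic_def
    proof
      fix x assume "x \<in> M"
      then have "{x} \<in> sets (restrict_space borel M)"
        using assms(4) by (simp add: sets_restrict_space_iff)
      then have "measure \<mu> {x} = measure N (\<Phi> -` {x} \<inter> space N)"
        unfolding \<mu>_def by (rule measure_distr[OF \<Phi>])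
      also have "\<dots> = 0"
        using countable_imp_null_set_lborel[OF fibre[of x]]
        by (intro measure_eq_0_null_sets) (simp add: N_null space_N)
      finally show "measure \<mu> {x} = 0" .
    qed
    fix n A assume A: "A \<in> sets \<mu>" "K n \<subseteq> A"
    have sub: "{real n..<real n + 1} \<subseteq> \<Phi> -` A \<inter> space N"
    proof
      fix t assume "t \<in> {real n..<real n + 1}"
      then have "\<lfloor>t\<rfloor> = int n" by (simp add: floor_eq_iff)
      then have "\<Phi> t \<in> K n"
        using \<phi>(2)[of n] by (auto simp: \<Phi>_def)
      then show "t \<in> \<Phi> -` A \<inter> space N"
        using A(2) by (auto simp: N_def)
    qed
    have "{real n..<real n + 1} \<notin> null_sets N"
      unfolding N_null by (auto simp: null_sets_def)
    then have "0 < measure N {real n..<real n + 1}"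
      by (simp add: null_sets_def N.emeasure_eq_measure zero_less_measure_iff) (simp add: N_def)
    also have "measure N {real n..<real n + 1} \<le> measure N (\<Phi> -` A \<inter> space N)"
      by (rule N.finite_measure_mono[OF sub]) (use A \<Phi> in \<open>auto simp: \<mu>_def\<close>)
    also have "\<dots> = measure \<mu> A"
      using A unfolding \<mu>_def by (simp add: measure_distr[OF \<Phi>])
    finally show "0 < measure \<mu> A" .
  qed
qed

section \<open>Dynamical balls\<close>

lemma continuous_on_funpow:
  assumes "continuous_on S h" "h ` S \<subseteq> S"
  shows "continuous_on S (h ^^ n) \<and> (h ^^ n) ` S \<subseteq> S"
proof (induction n)
  case (Suc n)
  then have "continuous_on S (h \<circ> h ^^ n)"
    by (intro continuous_on_compose) (auto intro: continuous_on_subset[OF assms(1)])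
  with Suc assms(2) show ?case by auto
qed (auto simp: id_def)

lemma continuous_on_int_iterate:
  assumes "homeomorphism M M f g"
  shows "continuous_on M (int_iterate M f n)"
proof -
  have f: "continuous_on M f" "f ` M = M" and g: "continuous_on M g" "g ` M = M"
    and gf: "\<And>x. x \<in> M \<Longrightarrow> g (f x) = x" and fg: "\<And>x. x \<in> M \<Longrightarrow> f (g x) = x"
    using assms by (auto simp: homeomorphism_def)
  have "inj_on f M" using gf by (rule inj_on_inverseI)
  \<comment> \<open>The inverse used for negative iterates agrees on \<open>M\<close> with the
    continuous inverse \<open>g\<close>.\<close>
  then have eq: "inv_into M f x = g x" if "x \<in> M" for x
    using that g(2) fg by (intro inv_into_f_eq) auto
  have "continuous_on M (inv_into M f)"
    using g(1) eq by (simp cong: continuous_on_cong)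
  moreover have "inv_into M f ` M \<subseteq> M"
    using eq g(2) by auto
  ultimately show ?thesis
    using continuous_on_funpow[of M f] continuous_on_funpow[of M "inv_into M f"] f
    unfolding int_iterate_def by simp
qed

text \<open>An intersection over \<open>n\<close> of closed conditions. Closedness supplies both the
  compactness and the measurability of dynamical balls.\<close>

lemma closed_dyn_ball:
  assumes "compact M" "homeomorphism M M f g"
  shows "closed (dyn_ball M f \<delta> x)"
proof -
  have "dyn_ball M f \<delta> x =
      (\<Inter>n. {y \<in> M. dist (int_iterate M f n x) (int_iterate M f n y) \<le> \<delta>})"
    by (auto simp: dyn_ball_def)
  also have "closed \<dots>"
    using continuous_on_int_iterate[OF assms(2)] compact_imp_closed[OF assms(1)]
    by (intro closed_INT ballI continuous_on_closed_Collect_le continuous_intros)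
  finally show ?thesis .
qed

theorem theorem2p1:
  fixes M :: "'a::metric_space set" and f g :: "'a \<Rightarrow> 'a"
  assumes "compact M"
    and "homeomorphism M M f g"
  shows "countably_expansive M f \<longleftrightarrow> measure_expansive M f"
proof
  assume "countably_expansive M f"
  then obtain \<delta> where \<delta>: "0 < \<delta>" "\<And>x. x \<in> M \<Longrightarrow> countable (dyn_ball M f \<delta> x)"
    by (auto simp: countably_expansive_def)
  \<comment> \<open>The same \<open>\<delta>\<close> works for every non-atomic
    \<open>\<mu>\<close>.\<close>
  have "measure \<mu> (dyn_ball M f \<delta> x) = 0"
    if \<mu>: "borel_prob_on M \<mu>" "non_atomic M \<mu>" and "x \<in> M" for \<mu> x
  proof -
    interpret prob_space \<mu> using \<mu>(1) by (simp add: borel_prob_on_def)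
    have "{y} \<in> null_sets \<mu>" if "y \<in> M" for y
    proof -
      have "{y} \<in> sets \<mu>"
        using that \<mu>(1) compact_imp_closed[OF assms(1)]
        by (simp add: borel_prob_on_def sets_restrict_space_iff)
      then show ?thesis
        using \<mu>(2) that by (simp add: null_sets_def emeasure_eq_measure non_atomic_def)
    qed
    then have "(\<Union>y\<in>dyn_ball M f \<delta> x. {y}) \<in> null_sets \<mu>"
      using \<delta>(2)[OF \<open>x \<in> M\<close>] by (intro null_sets_UN') (auto simp: dyn_ball_def)
    then show ?thesis
      by (simp add: measure_eq_0_null_sets)
  qed
  with \<delta>(1) show "measure_expansive M f"
    by (auto simp: measure_expansive_def mu_expansive_def)
next
  assume me: "measure_expansive M f"
  show "countably_expansive M f"
  proof (rule ccontr)
    assume "\<not> countably_expansive M f"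
    then have "\<exists>x\<in>M. uncountable (dyn_ball M f (1 / Suc n) x)" for n
      by (simp add: countably_expansive_def)
    then obtain x where x: "\<And>n. x n \<in> M" "\<And>n. uncountable (dyn_ball M f (1 / Suc n) (x n))"
      by metis
    have sub: "dyn_ball M f \<delta> y \<subseteq> M" for \<delta> y
      by (auto simp: dyn_ball_def)
    have closed: "closed (dyn_ball M f \<delta> y)" for \<delta> y
      by (rule closed_dyn_ball[OF assms])
    have compact: "compact (dyn_ball M f \<delta> y)" for \<delta> y
      using compact_Int_closed[OF assms(1) closed] sub by (simp add: Int_absorb1)
    obtain \<mu> where \<mu>: "borel_prob_on M \<mu>" "non_atomic M \<mu>"
      "\<And>n A. A \<in> sets \<mu> \<Longrightarrow> dyn_ball M f (1 / Suc n) (x n) \<subseteq> A \<Longrightarrow> 0 < measure \<mu> A"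
      by (rule ex_non_atomic_positive_on[of "\<lambda>n. dyn_ball M f (1 / Suc n) (x n)" M,
            OF compact x(2) sub compact_imp_closed[OF assms(1)]]) (rule that)
    obtain \<delta> where \<delta>: "0 < \<delta>" "\<And>x. x \<in> M \<Longrightarrow> measure \<mu> (dyn_ball M f \<delta> x) = 0"
      using me \<mu>(1,2) by (auto simp: measure_expansive_def mu_expansive_def)
    \<comment> \<open>Dynamical balls grow with the radius, so the \<open>\<delta>\<close>-ball
      around \<open>x n\<close> contains an uncountable ball that \<open>\<mu>\<close>
      charges.\<close>
    obtain n where n: "1 / Suc n < \<delta>"
      using reals_Archimedean[OF \<delta>(1)] by (auto simp: inverse_eq_divide)
    have "0 < measure \<mu> (dyn_ball M f \<delta> (x n))"
    proof (rule \<mu>(3))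
      show "dyn_ball M f \<delta> (x n) \<in> sets \<mu>"
        using \<mu>(1) closed sub compact_imp_closed[OF assms(1)]
        by (simp add: borel_prob_on_def sets_restrict_space_iff)
      show "dyn_ball M f (1 / Suc n) (x n) \<subseteq> dyn_ball M f \<delta> (x n)"
        using n by (fastforce simp: dyn_ball_def simp del: of_nat_Suc intro: order_trans)
    qed
    with \<delta>(2)[OF x(1)] show False by simp
  qed
qed

end
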